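(* Let $B=5$, let $\tilde p\neq0$ be an integer and $\tilde q$ a positive integer with $\tilde q\geqslant 3600\sqrt[3]{|\tilde p|}$. Let $F_1=B^{2}\tilde q^{6}+2B\tilde q^{4}-2B\tilde p\tilde q^{3}-2\tilde q^{2}-2\tilde p\tilde q+\tilde p^{2}+\frac5B-\frac{20}{B^{2}\tilde q^{2}}$, and consider the set of real $t$ with $F_1+\frac{10\tilde p}{B^{2}\tilde q^{3}}<t<F_1$ if $\tilde p<0$, respectively $F_1<t<F_1+\frac{10\tilde p}{B^{2}\tilde q^{3}}$ if $\tilde p>0$. This set contains at most one integer; an integer can occur only when $\tilde p>0$, and then it is $t=25\tilde q^{6}+10\tilde q^{4}-10\tilde p\tilde q^{3}-2\tilde q^{2}-2\tilde p\tilde q+\tilde p^{2}+1$. *)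

theory Defs
  imports Complex_Main
begin

definition F1 :: "real \<Rightarrow> int \<Rightarrow> int \<Rightarrow> real" where
  "F1 B p q = B^2 * q^6 + 2 * B * q^4 - 2 * B * p * q^3 - 2 * q^2 - 2 * p * q + p^2
     + 5 / B - 20 / (B^2 * q^2)"

definition t_set :: "real \<Rightarrow> int \<Rightarrow> int \<Rightarrow> real set" where
  "t_set B p q =
     {t. (p < 0 \<and> F1 B p q + 10 * p / (B^2 * q^3) < t \<and> t < F1 B p q) \<or>
         (p > 0 \<and> F1 B p q < t \<and> t < F1 B p q + 10 * p / (B^2 * q^3))}"

end

theory Submission imports Defs begin

text \<open>The interval \<open>t_set B p q\<close> has \<open>F1 B p q\<close> as an endpoint. If its width together with the
  distance from \<open>F1 B p q\<close> up to \<open>\<lceil>F1 B p q\<rceil>\<close> is less than \<open>1\<close>, then an interval to the left of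
  \<open>F1 B p q\<close> contains no integer, and one to the right contains none except possibly
  \<open>\<lceil>F1 B p q\<rceil>\<close>. When \<open>B\<close> is an integer dividing \<open>5\<close>, that distance is the only fractional term
  \<open>20/(B\<^sup>2q\<^sup>2)\<close> of \<open>F1\<close>, and the lower bound on \<open>q\<close> makes it and the width small.\<close>

lemma power_mult_le_power_if_mult_root_le:
  fixes c x y :: real
  assumes "0 < k" "0 \<le> c" "0 \<le> x" "c * root k x \<le> y"
  shows "c ^ k * x \<le> y ^ k"
proof -
  have "c ^ k * x = (c * root k x) ^ k"
    using assms by (simp add: power_mult_distrib)
  also have "\<dots> \<le> y ^ k"
    using assms by (intro power_mono) simp_all
  finally show ?thesis .
qed

lemma F1_corrections_less_1:
  fixes B p q :: real
  assumes "1 \<le> \<bar>B\<bar>" "7 \<le> q" "20 * \<bar>p\<bar> \<le> q ^ 3"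
  shows "20 / (B\<^sup>2 * q\<^sup>2) + \<bar>10 * p / (B\<^sup>2 * q ^ 3)\<bar> < 1"
proof -
  have "1 \<le> B\<^sup>2"
    using power_mono[OF assms(1), of 2] by simp
  then have scale: "x \<le> B\<^sup>2 * x" if "0 \<le> x" for x
    using that mult_right_mono[of 1 "B\<^sup>2" x] by simp
  have "7\<^sup>2 \<le> q\<^sup>2"
    using assms(2) by (intro power_mono) simp_all
  then have "40 < B\<^sup>2 * q\<^sup>2"
    using scale[of "q\<^sup>2"] by simp
  then have gap: "20 / (B\<^sup>2 * q\<^sup>2) < 1 / 2"
    by (simp add: divide_less_eq)
  have "0 < q ^ 3"
    using assms(2) by simp
  then have "0 < B\<^sup>2 * q ^ 3" "20 * \<bar>p\<bar> \<le> B\<^sup>2 * q ^ 3"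
    using scale[of "q ^ 3"] assms(3) by linarith+
  then have "\<bar>10 * p / (B\<^sup>2 * q ^ 3)\<bar> \<le> 1 / 2"
    by (simp add: abs_divide divide_le_eq)
  with gap show ?thesis by linarith
qed

definition F1_int :: "int \<Rightarrow> int \<Rightarrow> int \<Rightarrow> int" where
  "F1_int b p q = b\<^sup>2 * q ^ 6 + 2 * b * q ^ 4 - 2 * b * p * q ^ 3 - 2 * q\<^sup>2 - 2 * p * q + p\<^sup>2
     + 5 div b"

lemma F1_of_int_eq:
  assumes "b dvd 5"
  shows "F1 (of_int b) p q = of_int (F1_int b p q) - 20 / ((of_int b)\<^sup>2 * (of_int q)\<^sup>2)"
  using real_of_int_div[OF assms] by (simp add: F1_def F1_int_def)

lemma ceiling_F1_of_int:
  assumes "b dvd 5" "20 / ((real_of_int b)\<^sup>2 * (of_int q)\<^sup>2) < 1"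
  shows "\<lceil>F1 (of_int b) p q\<rceil> = F1_int b p q"
  using assms(2) by (intro ceiling_unique) (simp_all add: F1_of_int_eq[OF assms(1)])

lemma int_in_t_set_imp_eq_ceiling:
  assumes narrow: "of_int \<lceil>F1 B p q\<rceil> - F1 B p q + \<bar>10 * of_int p / (B\<^sup>2 * of_int q ^ 3)\<bar> < 1"
    and n: "real_of_int n \<in> t_set B p q"
  shows "0 < p \<and> n = \<lceil>F1 B p q\<rceil>"
proof -
  define w where "w = 10 * real_of_int p / (B\<^sup>2 * of_int q ^ 3)"
  note narrow = narrow[folded w_def]
  have F1_le: "F1 B p q \<le> of_int \<lceil>F1 B p q\<rceil>"
    by (rule le_of_int_ceiling)
  consider (left) "F1 B p q + w < n" "n < F1 B p q"
    | (right) "0 < p" "F1 B p q < n" "n < F1 B p q + w"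
    using n by (auto simp: t_set_def w_def)
  then show ?thesis
  proof cases
    case left
    have "real_of_int (\<lceil>F1 B p q\<rceil> - 1) < n" "real_of_int n < \<lceil>F1 B p q\<rceil>"
      using left narrow F1_le by linarith+
    then have "\<lceil>F1 B p q\<rceil> - 1 < n" "n < \<lceil>F1 B p q\<rceil>"
      by (simp_all only: of_int_less_iff)
    then show ?thesis by linarith
  next
    case right
    have "real_of_int n < of_int (\<lceil>F1 B p q\<rceil> + 1)"
      using right narrow F1_le by linarith
    then have "n < \<lceil>F1 B p q\<rceil> + 1"
      by (simp only: of_int_less_iff)
    moreover have "\<lceil>F1 B p q\<rceil> \<le> n"
      using right by (simp add: ceiling_le_iff)
    ultimately show ?thesis using right by linarith
  qed
qed

lemma int_in_t_set_imp_eq_F1_int: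
  assumes "b dvd 5" "7 \<le> q" "20 * \<bar>real_of_int p\<bar> \<le> of_int q ^ 3"
    and "real_of_int n \<in> t_set (of_int b) p q"
  shows "0 < p \<and> n = F1_int b p q"
proof -
  have "b \<noteq> 0" using assms(1) by auto
  then have b: "1 \<le> \<bar>real_of_int b\<bar>" by linarith
  have small: "20 / ((real_of_int b)\<^sup>2 * (of_int q)\<^sup>2)
      + \<bar>10 * of_int p / ((of_int b)\<^sup>2 * of_int q ^ 3)\<bar> < 1"
    using b assms(2,3) by (intro F1_corrections_less_1) simp_all
  then have "\<lceil>F1 (of_int b) p q\<rceil> = F1_int b p q"
    using assms(1) by (intro ceiling_F1_of_int) linarith+
  with small show ?thesis
    using int_in_t_set_imp_eq_ceiling[OF _ assms(4)] by (simp add: F1_of_int_eq[OF assms(1)])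
qed

theorem theorem7p4:
  fixes B :: real and p q :: int
  assumes "B = 5"
    and "p \<noteq> 0"
    and "q > 0"
    and "real_of_int q \<ge> 3600 * root 3 \<bar>real_of_int p\<bar>"
  shows "(\<exists>\<^sub>\<le>\<^sub>1 n :: int. real_of_int n \<in> t_set B p q) \<and>
    (\<forall>n :: int. real_of_int n \<in> t_set B p q \<longrightarrow>
      p > 0 \<and>
      n = 25 * q^6 + 10 * q^4 - 10 * p * q^3 - 2 * q^2 - 2 * p * q + p^2 + 1)"
proof -
  have "1 \<le> root 3 \<bar>real_of_int p\<bar>"
    using \<open>p \<noteq> 0\<close> by simp
  with assms(4) have q: "7 \<le> q" by linarith
  have "3600 ^ 3 * \<bar>real_of_int p\<bar> \<le> of_int q ^ 3"
    using assms(4) by (intro power_mult_le_power_if_mult_root_le) simp_all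
  then have pq: "20 * \<bar>real_of_int p\<bar> \<le> of_int q ^ 3" by simp
  have "0 < p \<and> n = F1_int 5 p q" if "real_of_int n \<in> t_set B p q" for n
    using int_in_t_set_imp_eq_F1_int[of 5 q p n] q pq that \<open>B = 5\<close> by simp
  then show ?thesis
    unfolding Uniq_def F1_int_def by auto
qed

end
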